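(* Let $p$ be an odd prime. Then $|L_p(n)|\ll\log n$ as $n\to\infty$; furthermore, $$\max_{n\le x}|L_p(n)|\asymp\log x$$ as $x\to\infty$, where the implied constants may depend on $p$.
   Context: For an odd prime $p$, $\lambda_p$ is the completely multiplicative function with $\lambda_p(p)=1$ and $\lambda_p(q)=\left(\frac{q}{p}\right)$ (Legendre symbol) for primes $q\ne p$, and $L_p(n):=\sum_{k=1}^n\lambda_p(k)$. The maximum is over positive integers $n\le x$. $F\ll G$ means $|F|\le C\,G$ for some constant $C>0$ and all sufficiently large arguments, and $F\asymp G$ means $F\ll G$ and $G\ll F$. *)

theory Defs
  imports "HOL-Number_Theory.Number_Theory" "HOL-Library.Landau_Symbols"
begin

definition lambda_char :: "nat \<Rightarrow> nat \<Rightarrow> int" where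
  "lambda_char p n =
     (\<Prod>q\<in>#prime_factorization n. if q = p then 1 else Legendre (int q) (int p))"

lemma lambda_char_1: "lambda_char p 1 = 1"
  by (simp add: lambda_char_def)

lemma lambda_char_mult:
  assumes "m > 0" "n > 0"
  shows "lambda_char p (m * n) = lambda_char p m * lambda_char p n"
  using assms by (simp add: lambda_char_def prime_factorization_mult)

lemma lambda_char_self: "prime p \<Longrightarrow> lambda_char p p = 1"
  by (simp add: lambda_char_def prime_factorization_prime)

lemma lambda_char_prime:
  "prime q \<Longrightarrow> q \<noteq> p \<Longrightarrow> lambda_char p q = Legendre (int q) (int p)"
  by (simp add: lambda_char_def prime_factorization_prime)

text \<open>These properties determine \<^const>\<open>lambda_char\<close> on the positive integers.\<close>

lemma lambda_char_unique:
  fixes f :: "nat \<Rightarrow> int"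
  assumes one: "f 1 = 1"
    and mult: "\<And>m n. m > 0 \<Longrightarrow> n > 0 \<Longrightarrow> f (m * n) = f m * f n"
    and self: "f p = 1"
    and other: "\<And>q. prime q \<Longrightarrow> q \<noteq> p \<Longrightarrow> f q = Legendre (int q) (int p)"
    and "n > 0"
  shows "f n = lambda_char p n"
  using \<open>n > 0\<close>
proof (induction n rule: prime_divisors_induct)
  case (factor q n)
  then have pos: "q > 0" "n > 0" by (auto simp: prime_gt_0_nat)
  have "f q = lambda_char p q"
    using factor.hyps self other by (metis lambda_char_self lambda_char_prime)
  with factor pos show ?case by (simp add: mult lambda_char_mult)
qed (use one in \<open>simp_all add: lambda_char_def\<close>)

definition L_sum :: "nat \<Rightarrow> nat \<Rightarrow> int" where
  "L_sum p n = (\<Sum>k=1..n. lambda_char p k)"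

end

theory Submission imports Defs begin

text \<open>Separating the multiples of \<open>p\<close> and using that the Legendre symbol sums to zero over a full
  period gives \<open>L(pm + a) = L(m) + S(a)\<close> for \<open>0 \<le> a < p\<close>, where \<open>S(a)\<close> is the sum of the Legendre
  symbols of \<open>1, \<dots>, a\<close>. Hence \<open>L(n)\<close> is the sum of \<open>S(a)\<close> over the base-\<open>p\<close> digits \<open>a\<close> of \<open>n\<close>.
  This is at most \<open>p\<close> times the number of digits, and since \<open>S(1) = 1\<close>, it equals \<open>k\<close> when
  \<open>n = 1 + p + \<dots> + p\<^sup>k\<^sup>-\<^sup>1\<close>.\<close>

section \<open>Multiplicativity and vanishing period sum of the Legendre symbol\<close>

lemma Legendre_cong: "[a = b] (mod p) \<Longrightarrow> Legendre a p = Legendre b p"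
  by (simp add: Legendre_def QuadRes_def cong_def)

lemma abs_Legendre_le_1: "\<bar>Legendre a p\<bar> \<le> 1"
  by (simp add: Legendre_def)

lemma Legendre_1: "p > 1 \<Longrightarrow> Legendre 1 p = 1"
  unfolding Legendre_def QuadRes_def
  by (auto simp: cong_0_iff intro: exI[of _ 1])

text \<open>By Euler's criterion both sides are congruent modulo \<open>p\<close>. They differ by at
  most 2, which is less than \<open>p\<close>, so they are equal.\<close>

lemma Legendre_mult:
  assumes "prime p" "2 < p"
  shows "Legendre (a * b) (int p) = Legendre a (int p) * Legendre b (int p)"
proof -
  have "[Legendre (a * b) (int p) = (a * b) ^ ((p - 1) div 2)] (mod int p)"
    by (rule euler_criterion[OF assms])
  also have "(a * b) ^ ((p - 1) div 2) = a ^ ((p - 1) div 2) * b ^ ((p - 1) div 2)"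
    by (rule power_mult_distrib)
  also have "[\<dots> = Legendre a (int p) * Legendre b (int p)] (mod int p)"
    by (intro cong_mult cong_sym[OF euler_criterion[OF assms]])
  finally have "int p dvd Legendre (a * b) (int p) - Legendre a (int p) * Legendre b (int p)"
    (is "_ dvd ?d") by (simp add: cong_iff_dvd_diff)
  moreover have "\<bar>?d\<bar> \<le> 2"
    by (auto simp: Legendre_def)
  ultimately have "?d = 0"
    using assms(2) zdvd_imp_le[of "int p" "\<bar>?d\<bar>"] by force
  then show ?thesis by simp
qed

lemma Legendre_power:
  assumes "prime p" "2 < p"
  shows "Legendre (a ^ k) (int p) = Legendre a (int p) ^ k"
  using assms by (induction k) (simp_all add: Legendre_1 Legendre_mult)

text \<open>Since \<open>g\<close> has order \<open>p - 1\<close>, its power with exponent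
  \<open>(p - 1) div 2\<close> is not 1, so Euler's criterion excludes the value 1. Coprimality
  excludes 0.\<close>

lemma Legendre_primroot:
  assumes "prime p" "2 < p" and g: "residue_primroot p g"
  shows "Legendre (int g) (int p) = - 1"
proof -
  have cop: "coprime p g" and ord: "ord p g = p - 1"
    using g assms(1) by (auto simp: residue_primroot_def totient_prime)
  have "\<not> [g ^ ((p - 1) div 2) = 1] (mod p)"
  proof
    assume "[g ^ ((p - 1) div 2) = 1] (mod p)"
    then have "p - 1 dvd (p - 1) div 2"
      using ord ord_divides by metis
    then show False
      using assms(2) by (auto dest!: dvd_imp_le)
  qed
  then have "\<not> [int g ^ ((p - 1) div 2) = 1] (mod int p)"
    by (metis cong_int_iff of_nat_1 of_nat_power)
  then have "Legendre (int g) (int p) \<noteq> 1"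
    using euler_criterion[OF assms(1,2), of "int g"] by (metis cong_sym)
  moreover have "\<not> p dvd g"
    using cop assms(2) by (auto dest: coprime_common_divisor)
  ultimately show ?thesis
    by (auto simp: Legendre_def cong_0_iff)
qed

text \<open>Powers of a primitive root run through the nonzero residues, which turns the sum into an
  alternating sum of \<open>p - 1\<close> signs, an even number.\<close>

lemma sum_Legendre_eq_0:
  assumes "prime p" "2 < p"
  shows "(\<Sum>k=1..p - 1. Legendre (int k) (int p)) = 0"
proof -
  obtain g where "residue_primroot p g"
    using prime_primitive_root_exists[of p] assms by auto
  then have bij: "bij_betw (\<lambda>i. g ^ i mod p) {..<p - 1} (totatives p)"
    and g: "Legendre (int g) (int p) = - 1"
    using residue_primroot_is_generator[of p g] assms
    by (auto simp: totient_prime Legendre_primroot)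
  have "{1..p - 1} = totatives p"
    unfolding totatives_prime[OF assms(1)] using assms(2) by auto
  then have "(\<Sum>k=1..p - 1. Legendre (int k) (int p)) =
      (\<Sum>i<p - 1. Legendre (int (g ^ i mod p)) (int p))"
    using sum.reindex_bij_betw[OF bij, of "\<lambda>k. Legendre (int k) (int p)"] by simp
  also have "\<dots> = (\<Sum>i<p - 1. (- 1) ^ i)"
  proof (rule sum.cong[OF refl])
    fix i
    have "Legendre (int (g ^ i mod p)) (int p) = Legendre (int g ^ i) (int p)"
      by (intro Legendre_cong) (simp add: zmod_int)
    then show "Legendre (int (g ^ i mod p)) (int p) = (- 1) ^ i"
      using g assms by (simp add: Legendre_power)
  qed
  also have "\<dots> = 0"
  proof -
    have "(\<Sum>i<2 * m. (- 1 :: int) ^ i) = 0" for m :: nat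
      by (induction m) simp_all
    moreover have "even (p - 1)"
      using prime_odd_nat[OF assms] by simp
    ultimately show ?thesis by (metis evenE)
  qed
  finally show ?thesis .
qed

section \<open>The base-\<open>p\<close> digit recursion\<close>

lemma lambda_char_eq_Legendre:
  assumes "prime p" "2 < p" "\<not> p dvd n"
  shows "lambda_char p n = Legendre (int n) (int p)"
proof -
  have "n > 0" using assms(3) by (auto intro: Nat.gr0I)
  then show ?thesis
    using assms(3)
  proof (induction n rule: prime_divisors_induct)
    case (factor q n)
    \<comment> \<open>Nondivisibility passes to both factors, so the induction never meets
      \<open>p\<close>, the only prime at which the two functions differ.\<close>
    then have "q > 0" "n > 0" "q \<noteq> p" "\<not> p dvd n" by (auto simp: prime_gt_0_nat)
    with factor have "lambda_char p (q * n) = Legendre (int q) (int p) * Legendre (int n) (int p)"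
      by (simp add: lambda_char_mult lambda_char_prime)
    then show ?case
      using assms by (simp add: Legendre_mult)
  qed (use assms in \<open>simp_all add: lambda_char_def Legendre_1\<close>)
qed

text \<open>Induction on \<open>n\<close>: a new term prime to \<open>p\<close> extends the sum over
  the last digit, while a multiple of \<open>p\<close> takes the value at its quotient and so
  extends \<open>L_sum p (n div p)\<close>.\<close>

lemma L_sum_rec:
  assumes "prime p" "2 < p"
  shows "L_sum p n = L_sum p (n div p) + (\<Sum>k=1..n mod p. Legendre (int k) (int p))"
proof (induction n)
  case 0
  then show ?case by (simp add: L_sum_def)
next
  case (Suc n)
  have L_Suc: "L_sum p (Suc m) = L_sum p m + lambda_char p (Suc m)" for m
    by (simp add: L_sum_def)
  show ?case
  proof (cases "p dvd Suc n")
    case True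
    then obtain m where m: "Suc n = p * Suc m"
      by (metis dvdE mult_0_right nat.distinct(1) not0_implies_Suc)
    then have "n = (p - 1) + p * m"
      using assms(2) by simp
    \<comment> \<open>Just before a multiple of \<open>p\<close> the last digit is
      \<open>p - 1\<close>, so its sum covers a full period and vanishes; resetting the digit to 0
      loses nothing.\<close>
    then have "n div p = m" "n mod p = p - 1"
      using assms(2) by (simp_all only: div_mult_self2 mod_mult_self2) simp_all
    moreover have "lambda_char p (Suc n) = lambda_char p (Suc m)"
      unfolding m using assms by (simp add: lambda_char_mult lambda_char_self del: mult_Suc_right)
    moreover have "Suc n div p = Suc m" "Suc n mod p = 0"
      unfolding m using assms(2) by simp_all
    ultimately show ?thesis
      using Suc.IH sum_Legendre_eq_0[OF assms] by (simp add: L_Suc)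
  next
    case False
    then have "Suc n mod p = Suc (n mod p)" "Suc n div p = n div p"
      by (auto simp: mod_Suc div_Suc dvd_eq_mod_eq_0 split: if_splits)
    moreover have "Legendre (int (Suc n)) (int p) = Legendre (int (Suc (n mod p))) (int p)"
      using calculation by (intro Legendre_cong) (metis cong_int_iff cong_mod_right cong_refl)
    ultimately show ?thesis
      using Suc.IH lambda_char_eq_Legendre[OF assms False] by (simp add: L_Suc)
  qed
qed

section \<open>Logarithmic upper and lower bounds\<close>

lemma abs_L_sum_le:
  assumes "prime p" "2 < p" "n > 0"
  shows "real_of_int \<bar>L_sum p n\<bar> \<le> real p * (1 + log p n)"
  using \<open>n > 0\<close>
proof (induction n rule: less_induct)
  case (less n)
  have "\<bar>\<Sum>k=1..n mod p. Legendre (int k) (int p)\<bar> \<le> (\<Sum>k=1..n mod p. 1)"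
    by (intro order.trans[OF sum_abs] sum_mono abs_Legendre_le_1)
  also have "\<dots> \<le> int p"
    using assms(2) by (simp add: less_imp_le)
  finally have S: "\<bar>\<Sum>k=1..n mod p. Legendre (int k) (int p)\<bar> \<le> int p" .
  then have step: "real_of_int \<bar>L_sum p n\<bar> \<le> real_of_int \<bar>L_sum p (n div p)\<bar> + real p"
    using L_sum_rec[OF assms(1,2), of n] by linarith
  show ?case
  proof (cases "n < p")
    \<comment> \<open>A single digit: \<open>n div p = 0\<close>, and the summand 1 in the bound
      pays for the digit because \<open>log p n \<ge> 0\<close>.\<close>
    case True
    then have "real_of_int \<bar>L_sum p n\<bar> \<le> real p"
      using step by (simp add: L_sum_def)
    also have "\<dots> \<le> real p * (1 + log p n)"
      using less.prems assms(2) by simp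
    finally show ?thesis .
  next
    case False
    then have pos: "n div p > 0" and "n div p < n"
      using assms(2) less.prems by (simp_all add: div_greater_zero_iff)
    then have "real_of_int \<bar>L_sum p (n div p)\<bar> \<le> real p * (1 + log p (n div p))"
      by (intro less.IH)
    also have "\<dots> \<le> real p * (1 + log p (n / p))"
      using pos assms(2) of_nat_div_le_of_nat[of n p, where ?'a = real]
      by (intro mult_left_mono add_left_mono) (auto simp: divide_pos_pos)
    \<comment> \<open>Dividing by \<open>p\<close> lowers the logarithm by 1, which leaves room for
      the \<open>real p\<close> contributed by the last digit.\<close>
    also have "\<dots> = real p * log p n"
      using assms(2) less.prems by (simp add: log_divide)
    finally show ?thesis
      using step by (simp add: algebra_simps)
  qed
qed

text \<open>Appending the digit 1 raises the sum by \<open>Legendre 1 p = 1\<close> and multiplies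
  the size bound by \<open>p\<close>. The bound later keeps the witness below
  \<open>x\<close>.\<close>

lemma exists_L_sum_eq:
  assumes "prime p" "2 < p"
  shows "\<exists>n<p ^ k. L_sum p n = int k"
proof (induction k)
  case 0
  show ?case by (simp add: L_sum_def)
next
  case (Suc k)
  then obtain n where n: "n < p ^ k" "L_sum p n = int k" by blast
  have "(p * n + 1) div p = n" "(p * n + 1) mod p = 1"
    using assms(2) by (simp_all add: div_mult_self4 mod_mult_self4 del: add_Suc_right)
  then have "L_sum p (p * n + 1) = int (Suc k)"
    using L_sum_rec[OF assms, of "p * n + 1"] n(2) assms(2) by (simp add: Legendre_1)
  moreover have "p * n + 1 < p ^ Suc k"
  proof -
    have "p * n + 1 < p * Suc n" using assms(2) by simp
    also have "\<dots> \<le> p ^ Suc k"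
      unfolding power_Suc using n(1) by (intro mult_left_mono) auto
    finally show ?thesis .
  qed
  ultimately show ?case by blast
qed

theorem corollary6:
  fixes p :: nat
  assumes "prime p" and "odd p"
  shows "(\<lambda>n::nat. real_of_int \<bar>L_sum p n\<bar>) \<in> O(\<lambda>n. ln (real n)) \<and>
         (\<lambda>x::real. real_of_int (MAX n\<in>{n::nat. 1 \<le> n \<and> real n \<le> x}. \<bar>L_sum p n\<bar>))
           \<in> \<Theta>(\<lambda>x. ln x)"
proof -
  have p: "2 < p"
    using assms prime_ge_2_nat[of p] by (cases "p = 2") auto
  define M where "M x = (MAX n\<in>{n::nat. 1 \<le> n \<and> real n \<le> x}. \<bar>L_sum p n\<bar>)" for x :: real
  have upper: "real_of_int \<bar>L_sum p n\<bar> \<le> 2 * real p / ln p * ln x"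
    if "1 \<le> n" "real n \<le> x" "real p \<le> x" for n :: nat and x :: real
  proof -
    \<comment> \<open>For \<open>x \<ge> p\<close> the additive 1 of \<open>abs_L_sum_le\<close> is
      at most \<open>log p x\<close>; absorbing it gives the factor 2.\<close>
    have "log p n \<le> log p x" "1 \<le> log p x"
      using that p by (simp_all add: le_log_iff)
    then have "real p * (1 + log p n) \<le> real p * (2 * log p x)"
      by (intro mult_left_mono) auto
    also have "\<dots> = 2 * real p / ln p * ln x"
      by (simp add: log_def)
    finally show ?thesis
      using abs_L_sum_le[OF assms(1) p, of n] that(1) by linarith
  qed
  have fin: "finite {n::nat. 1 \<le> n \<and> real n \<le> x}" for x
    by (rule finite_subset[of _ "{..nat \<lfloor>x\<rfloor>}"]) (auto simp: le_nat_iff le_floor_iff)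
  have M_upper: "real_of_int \<bar>M x\<bar> \<le> 2 * real p / ln p * ln x"
    and M_lower: "ln x \<le> 2 * ln p * real_of_int \<bar>M x\<bar>" if x: "real p \<le> x" for x
  proof -
    \<comment> \<open>A nonempty range ensures that the maximum is attained, so that
      \<open>upper\<close> applies to it.\<close>
    have "{n::nat. 1 \<le> n \<and> real n \<le> x} \<noteq> {}"
      using x p by (auto intro!: exI[of _ 1])
    then have "M x \<in> (\<lambda>n. \<bar>L_sum p n\<bar>) ` {n::nat. 1 \<le> n \<and> real n \<le> x}"
      unfolding M_def using fin by (intro Max_in) auto
    then show "real_of_int \<bar>M x\<bar> \<le> 2 * real p / ln p * ln x"
      using upper[OF _ _ x] by auto
    \<comment> \<open>The largest exponent with \<open>p ^ k \<le> x\<close>.\<close>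
    define k where "k = nat \<lfloor>log p x\<rfloor>"
    have log: "1 \<le> log p x"
      using x p by (simp add: le_log_iff)
    then have k: "1 \<le> k" "real k \<le> log p x" "log p x < real k + 1"
      unfolding k_def by linarith+
    obtain n where n: "n < p ^ k" "L_sum p n = int k"
      using exists_L_sum_eq[OF assms(1) p] by blast
    \<comment> \<open>The range of the maximum starts at 1; a witness 0 would give the sum 0,
      contrary to \<open>k \<ge> 1\<close>.\<close>
    have "n \<noteq> 0"
      using n(2) k(1) by (auto simp: L_sum_def intro: ccontr)
    moreover have "real n \<le> x"
    proof -
      have "real n \<le> real p ^ k"
        using n(1) by (metis less_imp_le of_nat_le_iff of_nat_power)
      also have "\<dots> \<le> x"
        using k(2) p x by (simp add: le_log_iff powr_realpow)
      finally show ?thesis .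
    qed
    ultimately have "\<bar>L_sum p n\<bar> \<le> M x"
      unfolding M_def using fin by (intro Max_ge) auto
    then have "real k \<le> real_of_int \<bar>M x\<bar>"
      using n(2) by simp
    \<comment> \<open>Here \<open>log p x < k + 1 \<le> 2 * k\<close>, as
      \<open>k \<ge> 1\<close>.\<close>
    then have "log p x \<le> 2 * real_of_int \<bar>M x\<bar>"
      using k by linarith
    then show "ln x \<le> 2 * ln p * real_of_int \<bar>M x\<bar>"
      using p by (simp add: log_def field_simps)
  qed
  have "(\<lambda>n. real_of_int \<bar>L_sum p n\<bar>) \<in> O(\<lambda>n. ln (real n))"
  proof (rule bigoI[where c = "2 * real p / ln p"])
    show "\<forall>\<^sub>F n in at_top. norm (real_of_int \<bar>L_sum p n\<bar>) \<le> 2 * real p / ln p * norm (ln (real n))"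
      using eventually_ge_at_top[of p] by eventually_elim (use upper p in auto)
  qed
  moreover have "(\<lambda>x. real_of_int (M x)) \<in> \<Theta>(\<lambda>x. ln x)"
  proof (rule bigthetaI)
    show "(\<lambda>x. real_of_int (M x)) \<in> O(\<lambda>x. ln x)"
    proof (rule bigoI[where c = "2 * real p / ln p"])
      show "\<forall>\<^sub>F x in at_top. norm (real_of_int (M x)) \<le> 2 * real p / ln p * norm (ln x)"
        using eventually_ge_at_top[of "real p"] by eventually_elim (use M_upper p in auto)
    qed
    have "(\<lambda>x. ln x) \<in> O(\<lambda>x. real_of_int (M x))"
    proof (rule bigoI[where c = "2 * ln p"])
      show "\<forall>\<^sub>F x in at_top. norm (ln x) \<le> 2 * ln p * norm (real_of_int (M x))"
        using eventually_ge_at_top[of "real p"] by eventually_elim (use M_lower p in auto)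
    qed
    then show "(\<lambda>x. real_of_int (M x)) \<in> \<Omega>(\<lambda>x. ln x)"
      by (simp add: bigomega_iff_bigo)
  qed
  ultimately show ?thesis
    unfolding M_def by blast
qed

end
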